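(* Let $G=(V,E)$ be a finite connected loopless multigraph with site energies $x_v>0$ and edge energies $y_e>0$. Then for every $\alpha'>0$ $$\mathcal I_G^{\square}(\alpha')=\prod_{e\in E}\frac{\alpha'}{2}B(2\alpha' y_e,2\alpha' y_e),\qquad \lim_{\alpha'\to0^+}\mathcal I_G^{\square}(\alpha')=\prod_{e\in E}\frac1{2y_e},$$ and the complete stringy correlator $\mathcal I_G^{\mathrm{corr}}(\alpha')=\mathcal I_G^{\square}(\alpha')\,\mathcal I_G^{\mathrm{zono}}(\alpha')$ satisfies $$\lim_{\alpha'\to0^+}\mathcal I_G^{\mathrm{corr}}(\alpha')=\langle G\rangle .$$
   Context: Loopless means no self-loops; cycles and parallel edges are allowed. $B$ is the Euler beta function. The fixed-graph in-in correlator is $$\langle G\rangle=\Big(\prod_{e\in E}\frac1{2y_e}\Big)\int_{\mathbb R^{V}}\exp\Big[-\sum_{v\in V}x_v|t_v|-\sum_{e=uv\in E}y_e|t_u-t_v|\Big]\prod_{v\in V}\mathrm dt_v .$$ The edge-space and vertex-space stringy integrals are $$\mathcal I_G^{\square}(\alpha')=(\alpha')^{|E|}\int_{\mathbb R_{>0}^{E}}\prod_{e\in E}\frac{\mathrm dz_e}{z_e}\prod_{e\in E}(z_e+z_e^{-1})^{-4\alpha' y_e},$$ $$\mathcal I_G^{\mathrm{zono}}(\alpha')=(\alpha')^{|V|}\int_{\mathbb R_{>0}^{V}}\prod_{v\in V}\frac{\mathrm dz_v}{z_v}\prod_{v\in V}(z_v+z_v^{-1})^{-\alpha' x_v}\prod_{e=uv\in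 E}\Big(\frac{z_u}{z_v}+\frac{z_v}{z_u}\Big)^{-\alpha' y_e}.$$ *)

theory Defs
  imports "HOL-Analysis.Analysis" "HOL-Library.Uprod"
begin

section \<open>Finite multigraphs\<close>

text \<open>
  Edges carry their own identity, so distinct edges may have the same unordered
  pair of end points (parallel edges).
\<close>

record ('v, 'e) multigraph =
  verts :: "'v set"
  edges :: "'e set"
  ends :: "'e \<Rightarrow> 'v uprod"

locale fin_multigraph =
  fixes G :: "('v, 'e) multigraph"
  assumes finite_verts: "finite (verts G)"
    and finite_edges: "finite (edges G)"
    and ends_in_verts: "e \<in> edges G \<Longrightarrow> set_uprod (ends G e) \<subseteq> verts G"

definition loopless :: "('v, 'e) multigraph \<Rightarrow> bool" where
  "loopless G \<longleftrightarrow> (\<forall>e\<in>edges G. proper_uprod (ends G e))"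

definition adjacency :: "('v, 'e) multigraph \<Rightarrow> ('v \<times> 'v) set" where
  "adjacency G = {(u, v). \<exists>e\<in>edges G. ends G e = Upair u v}"

text \<open>As usual, the empty graph does not count as connected.\<close>

definition connected_multigraph :: "('v, 'e) multigraph \<Rightarrow> bool" where
  "connected_multigraph G \<longleftrightarrow>
     verts G \<noteq> {} \<and> (\<forall>u\<in>verts G. \<forall>v\<in>verts G. (u, v) \<in> (adjacency G)\<^sup>*)"

section \<open>Symmetric functions of the end points of an edge\<close>

lift_definition edge_dist :: "('v \<Rightarrow> real) \<Rightarrow> 'v uprod \<Rightarrow> real"
  is "\<lambda>t (u, v). \<bar>t u - t v\<bar>"
  by auto

lift_definition edge_ratio_sum :: "('v \<Rightarrow> real) \<Rightarrow> 'v uprod \<Rightarrow> real"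
  is "\<lambda>z (u, v). z u / z v + z v / z u"
  by auto

lemma edge_dist_Upair [simp]: "edge_dist t (Upair u v) = \<bar>t u - t v\<bar>"
  by transfer simp

lemma edge_ratio_sum_Upair [simp]: "edge_ratio_sum z (Upair u v) = z u / z v + z v / z u"
  by transfer simp

section \<open>The fixed-graph correlator and the stringy integrals\<close>

text \<open>
  Euclidean space \<open>\<real>\<^sup>I\<close> for a finite set \<open>I\<close> is \<open>\<Pi>\<^sub>M i\<in>I. lborel\<close>, whose
  points are the functions that are \<open>undefined\<close> outside \<open>I\<close>; for \<open>I = {}\<close> it is a
  single point of mass 1.
\<close>

definition graph_correlator ::
  "('v, 'e) multigraph \<Rightarrow> ('v \<Rightarrow> real) \<Rightarrow> ('e \<Rightarrow> real) \<Rightarrow> real" where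
  "graph_correlator G x y =
     (\<Prod>e\<in>edges G. 1 / (2 * y e)) *
     (LINT t|(\<Pi>\<^sub>M v\<in>verts G. lborel).
        exp (- (\<Sum>v\<in>verts G. x v * \<bar>t v\<bar>) - (\<Sum>e\<in>edges G. y e * edge_dist t (ends G e))))"

definition stringy_box ::
  "('v, 'e) multigraph \<Rightarrow> ('e \<Rightarrow> real) \<Rightarrow> real \<Rightarrow> real" where
  "stringy_box G y \<alpha> =
     \<alpha> ^ card (edges G) *
     (LINT z:(\<Pi>\<^sub>E e\<in>edges G. {0<..})|(\<Pi>\<^sub>M e\<in>edges G. lborel).
        (\<Prod>e\<in>edges G. 1 / z e) *
        (\<Prod>e\<in>edges G. (z e + inverse (z e)) powr (- (4 * \<alpha> * y e))))"

definition stringy_zono ::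
  "('v, 'e) multigraph \<Rightarrow> ('v \<Rightarrow> real) \<Rightarrow> ('e \<Rightarrow> real) \<Rightarrow> real \<Rightarrow> real" where
  "stringy_zono G x y \<alpha> =
     \<alpha> ^ card (verts G) *
     (LINT z:(\<Pi>\<^sub>E v\<in>verts G. {0<..})|(\<Pi>\<^sub>M v\<in>verts G. lborel).
        (\<Prod>v\<in>verts G. 1 / z v) *
        (\<Prod>v\<in>verts G. (z v + inverse (z v)) powr (- (\<alpha> * x v))) *
        (\<Prod>e\<in>edges G. edge_ratio_sum z (ends G e) powr (- (\<alpha> * y e))))"

definition stringy_corr ::
  "('v, 'e) multigraph \<Rightarrow> ('v \<Rightarrow> real) \<Rightarrow> ('e \<Rightarrow> real) \<Rightarrow> real \<Rightarrow> real" where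
  "stringy_corr G x y \<alpha> = stringy_box G y \<alpha> * stringy_zono G x y \<alpha>"

end

theory Submission
  imports Defs
begin

text \<open>
  In the coordinates \<open>t = \<alpha> ln z\<close> the measure \<open>\<alpha> dz / z\<close> becomes Lebesgue measure and each factor
  \<open>(z + 1/z) powr (- \<alpha> c)\<close> becomes \<open>(2 cosh (t / \<alpha>)) powr (- \<alpha> c)\<close>. Since
  \<open>exp \<bar>s\<bar> \<le> 2 cosh s \<le> 2 exp \<bar>s\<bar>\<close>, this factor is at most \<open>exp (- c \<bar>t\<bar>)\<close> and tends to it as
  \<open>\<alpha> \<rightarrow> 0\<close>, so the vertex-space integral converges by dominated convergence, the site factors
  alone being an integrable bound. The edge-space integral factorises into Beta integrals.
\<close>

section \<open>Logarithmic coordinates\<close>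

text \<open>Open intervals determine Lebesgue measure. The preimage of \<open>(l, u)\<close> among
  positive \<open>z\<close> is the interval from \<open>exp (l / \<alpha>)\<close> to
  \<open>exp (u / \<alpha>)\<close>, and \<open>\<alpha> * ln z\<close> is an antiderivative of the
  density there.\<close>

lemma distr_ln_lborel:
  fixes \<alpha> :: real
  assumes "\<alpha> > 0"
  shows "lborel = distr (density lborel (\<lambda>z. ennreal (indicator {0<..} z * (\<alpha> / z)))) borel (\<lambda>z. \<alpha> * ln z)"
    (is "_ = distr (density lborel ?w) borel ?g")
proof (rule lborel_eqI)
  fix l u :: real
  assume "\<And>b. b \<in> Basis \<Longrightarrow> l \<bullet> b \<le> u \<bullet> b"
  then have lu: "l \<le> u"
    by simp
  define a b where "a = exp (l / \<alpha>)" and "b = exp (u / \<alpha>)"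
  have ab: "0 < a" "a \<le> b"
    using lu assms by (auto simp: a_def b_def divide_right_mono)
  have mem: "l < \<alpha> * ln z \<and> \<alpha> * ln z < u \<longleftrightarrow> a < z \<and> z < b" if "z > 0" for z
  proof -
    have "l < \<alpha> * ln z \<longleftrightarrow> l / \<alpha> < ln z" "\<alpha> * ln z < u \<longleftrightarrow> ln z < u / \<alpha>"
      using assms by (auto simp: field_simps)
    then show ?thesis
      using that by (metis a_def b_def exp_less_cancel_iff exp_ln)
  qed
  have "emeasure (distr (density lborel ?w) borel ?g) (box l u)
      = (\<integral>\<^sup>+z. ?w z * indicator (?g -` box l u) z \<partial>lborel)"
    using measurable_sets[of ?g borel borel "box l u"]
    by (subst emeasure_distr) (auto simp: emeasure_density)
  also have "\<dots> = (\<integral>\<^sup>+z. ennreal (\<alpha> / z) * indicator {a..b} z \<partial>lborel)"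
  proof (rule nn_integral_cong_AE)
    \<comment> \<open>The open interval may be closed, its end points being null sets. For
      \<open>z \<le> 0\<close> both sides vanish, whatever value \<open>ln z\<close> has.\<close>
    show "AE z in lborel. ?w z * indicator (?g -` box l u) z = ennreal (\<alpha> / z) * indicator {a..b} z"
      using AE_lborel_singleton[of a] AE_lborel_singleton[of b]
    proof eventually_elim
      case (elim z)
      then show ?case
        using mem[of z] ab by (cases "z > 0") (auto simp: indicator_def box_real)
    qed
  qed
  also have "\<dots> = ennreal (\<alpha> * ln b - \<alpha> * ln a)"
  proof (rule nn_integral_FTC_Icc)
    fix z assume "z \<in> {a..b}"
    then have "z > 0" using ab by auto
    then show "((\<lambda>z. \<alpha> * ln z) has_real_derivative \<alpha> / z) (at z)"
      by (auto intro!: derivative_eq_intros)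
    show "0 \<le> \<alpha> / z" using \<open>z > 0\<close> assms by simp
  qed (use ab in auto)
  also have "\<alpha> * ln b - \<alpha> * ln a = u - l"
    using assms by (simp add: a_def b_def)
  finally show "emeasure (distr (density lborel ?w) borel ?g) (box l u)
      = ennreal (\<Prod>b\<in>Basis. (u - l) \<bullet> b)"
    by simp
qed simp

section \<open>Finite powers of Lebesgue measure\<close>

interpretation lborel_PiM: product_sigma_finite "\<lambda>_. lborel :: real measure"
  by standard

text \<open>Rectangles determine the product measure. On a rectangle both the density and the
  indicator of the preimage factor over the coordinates, so the claim reduces to
  \<open>distr_ln_lborel\<close>.\<close>

lemma distr_ln_PiM_lborel:
  fixes \<alpha> :: real
  assumes "finite I" and "\<alpha> > 0"
  shows "distr (density (\<Pi>\<^sub>M i\<in>I. lborel) (\<lambda>z. ennreal (\<Prod>i\<in>I. indicator {0<..} (z i) * (\<alpha> / z i))))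
           (\<Pi>\<^sub>M i\<in>I. lborel) (\<lambda>z. \<lambda>i\<in>I. \<alpha> * ln (z i)) = (\<Pi>\<^sub>M i\<in>I. lborel)"
    (is "distr (density ?P ?w) _ ?T = _")
proof (rule lborel_PiM.PiM_eqI)
  let ?w1 = "\<lambda>z::real. ennreal (indicator {0<..} z * (\<alpha> / z))"
  fix A :: "'a \<Rightarrow> real set"
  assume A: "\<And>i. i \<in> I \<Longrightarrow> A i \<in> sets lborel"
  have T [measurable]: "?T \<in> ?P \<rightarrow>\<^sub>M ?P"
    by measurable
  have PA [measurable]: "Pi\<^sub>E I A \<in> sets ?P"
    using assms A by (intro sets_PiM_I_finite) auto
  have pre: "?T -` Pi\<^sub>E I A \<inter> space ?P \<in> sets ?P"
    using measurable_sets[OF T PA] .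
  have "emeasure (distr (density ?P ?w) ?P ?T) (Pi\<^sub>E I A)
      = (\<integral>\<^sup>+z. ?w z * indicator (?T -` Pi\<^sub>E I A \<inter> space ?P) z \<partial>?P)"
    using pre by (subst emeasure_distr) (auto simp: emeasure_density)
  also have "\<dots> = (\<integral>\<^sup>+z. (\<Prod>i\<in>I. ?w1 (z i) * indicator ((\<lambda>z. \<alpha> * ln z) -` A i) (z i)) \<partial>?P)"
  proof (rule nn_integral_cong)
    fix z assume z: "z \<in> space ?P"
    have "indicator (?T -` Pi\<^sub>E I A \<inter> space ?P) z
        = (\<Prod>i\<in>I. indicator ((\<lambda>z. \<alpha> * ln z) -` A i) (z i) :: ennreal)"
    proof (cases "\<forall>i\<in>I. \<alpha> * ln (z i) \<in> A i")
      case True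
      then show ?thesis using z by (auto simp: indicator_def PiE_iff intro!: prod.neutral[symmetric])
    next
      case False
      then obtain i where i: "i \<in> I" "\<alpha> * ln (z i) \<notin> A i" by auto
      then have "(\<Prod>i\<in>I. indicator ((\<lambda>z. \<alpha> * ln z) -` A i) (z i) :: ennreal) = 0"
        using assms by (intro prod_zero bexI[of _ i]) auto
      then show ?thesis using i by (auto simp: indicator_def PiE_iff)
    qed
    moreover have "?w z = (\<Prod>i\<in>I. ?w1 (z i))"
      using assms by (subst prod_ennreal) (auto simp: indicator_def)
    ultimately show "?w z * indicator (?T -` Pi\<^sub>E I A \<inter> space ?P) z
        = (\<Prod>i\<in>I. ?w1 (z i) * indicator ((\<lambda>z. \<alpha> * ln z) -` A i) (z i))"
      by (simp add: prod.distrib)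
  qed
  also have "\<dots> = (\<Prod>i\<in>I. \<integral>\<^sup>+z. ?w1 z * indicator ((\<lambda>z. \<alpha> * ln z) -` A i) z \<partial>lborel)"
  proof (rule lborel_PiM.product_nn_integral_prod[OF assms(1)])
    fix i assume "i \<in> I"
    then have [measurable]: "A i \<in> sets borel" using A by simp
    show "(\<lambda>z. ?w1 z * indicator ((\<lambda>z. \<alpha> * ln z) -` A i) z) \<in> borel_measurable lborel"
      by measurable
  qed
  also have "\<dots> = (\<Prod>i\<in>I. emeasure lborel (A i))"
  proof (rule prod.cong[OF refl])
    fix i assume "i \<in> I"
    then have [measurable]: "A i \<in> sets borel" using A by simp
    have "emeasure lborel (A i) = emeasure (distr (density lborel ?w1) borel (\<lambda>z. \<alpha> * ln z)) (A i)"
      using distr_ln_lborel[OF assms(2)] by metis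
    also have "\<dots> = (\<integral>\<^sup>+z. ?w1 z * indicator ((\<lambda>z. \<alpha> * ln z) -` A i) z \<partial>lborel)"
      using measurable_sets[of "\<lambda>z. \<alpha> * ln z" borel borel "A i"]
      by (subst emeasure_distr) (auto simp: emeasure_density)
    finally show "(\<integral>\<^sup>+z. ?w1 z * indicator ((\<lambda>z. \<alpha> * ln z) -` A i) z \<partial>lborel) = emeasure lborel (A i)"
      by simp
  qed
  finally show "emeasure (distr (density ?P ?w) ?P ?T) (Pi\<^sub>E I A) = (\<Prod>i\<in>I. emeasure lborel (A i))" .
qed (use assms in auto)

text \<open>The product sees only the coordinates in \<open>I\<close>; extensionality supplies the
  rest of membership in the dependent product. Points of the product space are extensional.\<close>

lemma indicator_PiE_extensional:
  fixes z :: "'i \<Rightarrow> 'b"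
  assumes "finite I" and "z \<in> extensional I"
  shows "indicator (\<Pi>\<^sub>E i\<in>I. A i) z = (\<Prod>i\<in>I. indicator (A i) (z i) :: real)"
proof (cases "\<forall>i\<in>I. z i \<in> A i")
  case True
  then show ?thesis using assms by (auto simp: indicator_def PiE_iff)
next
  case False
  then obtain i where i: "i \<in> I" "z i \<notin> A i" by auto
  then have "(\<Prod>i\<in>I. indicator (A i) (z i) :: real) = 0"
    using assms by (intro prod_zero bexI[of _ i]) auto
  then show ?thesis using i by (auto simp: indicator_def PiE_iff)
qed

text \<open>Integration against the pushforward of \<open>distr_ln_PiM_lborel\<close>, with the
  density then pulled into the integrand. If \<open>f\<close> is not integrable, both integrals take
  the default value 0.\<close>

lemma integral_ln_substitution:
  fixes f :: "('i \<Rightarrow> real) \<Rightarrow> real"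
  assumes "finite I" and "\<alpha> > 0"
    and f [measurable]: "f \<in> borel_measurable (\<Pi>\<^sub>M i\<in>I. lborel)"
  shows "\<alpha> ^ card I * (LINT z:(\<Pi>\<^sub>E i\<in>I. {0<..})|(\<Pi>\<^sub>M i\<in>I. lborel).
            (\<Prod>i\<in>I. 1 / z i) * f (\<lambda>i\<in>I. \<alpha> * ln (z i)))
         = (LINT t|(\<Pi>\<^sub>M i\<in>I. lborel). f t)"
proof -
  let ?P = "\<Pi>\<^sub>M i\<in>I. (lborel :: real measure)"
  let ?w = "\<lambda>z. \<Prod>i\<in>I. indicator {0<..} (z i) * (\<alpha> / z i)"
  let ?T = "\<lambda>z. \<lambda>i\<in>I. \<alpha> * ln (z i)"
  have T [measurable]: "?T \<in> ?P \<rightarrow>\<^sub>M ?P"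
    by measurable
  have w [measurable]: "?w \<in> borel_measurable ?P"
    by measurable
  have w_nonneg: "0 \<le> ?w z" for z
    using assms by (intro prod_nonneg) (auto simp: indicator_def)
  have "(LINT t|?P. f t) = (LINT t|distr (density ?P ?w) ?P ?T. f t)"
    using assms(1,2) by (subst distr_ln_PiM_lborel) auto
  also have "\<dots> = (LINT z|density ?P ?w. f (?T z))"
    by (rule integral_distr) auto
  also have "\<dots> = (LINT z|?P. ?w z *\<^sub>R f (?T z))"
    using w_nonneg by (intro integral_density) auto
  also have "\<dots> = (LINT z|?P. \<alpha> ^ card I * (indicator (\<Pi>\<^sub>E i\<in>I. {0<..}) z *\<^sub>R ((\<Prod>i\<in>I. 1 / z i) * f (?T z))))"
  proof (rule Bochner_Integration.integral_cong[OF refl])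
    fix z assume "z \<in> space ?P"
    then have "z \<in> extensional I" by (auto simp: space_PiM PiE_iff)
    then have "?w z = indicator (\<Pi>\<^sub>E i\<in>I. {0<..}) z * (\<alpha> ^ card I * (\<Prod>i\<in>I. 1 / z i))"
      using assms by (simp add: indicator_PiE_extensional prod.distrib prod_dividef)
    then show "?w z *\<^sub>R f (?T z)
        = \<alpha> ^ card I * (indicator (\<Pi>\<^sub>E i\<in>I. {0<..}) z *\<^sub>R ((\<Prod>i\<in>I. 1 / z i) * f (?T z)))"
      by simp
  qed
  finally show ?thesis
    by (simp add: set_lebesgue_integral_def)
qed

section \<open>The edge-space integral\<close>

lemma has_bochner_integral_Beta_symmetric:
  fixes a :: real
  assumes "a > 0"
  shows "has_bochner_integral lborel
           (\<lambda>z. indicator {0<..} z * (1 / z * (z + inverse z) powr (- (2 * a)))) (Beta a a / 2)"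
proof -
  \<comment> \<open>The substitution \<open>u = g z\<close> satisfies \<open>u (1 - u) = 1 / (z + 1/z)\<^sup>2\<close> and \<open>du / (u (1 - u)) = 2 dz / z\<close>.\<close>
  define g where "g = (\<lambda>z::real. z\<^sup>2 / (1 + z\<^sup>2))"
  define g' where "g' = (\<lambda>z::real. 2 * z / (1 + z\<^sup>2)\<^sup>2)"
  define f where "f = (\<lambda>u::real. u powr (a - 1) * (1 - u) powr (a - 1))"
  define h where "h = (\<lambda>z::real. 1 / z * (z + inverse z) powr (- (2 * a)))"
  have pos: "1 + z\<^sup>2 > 0" for z :: real
    by (simp add: add_pos_nonneg)
  have inj: "inj_on g {0<..}"
  proof (rule inj_onI)
    fix z w :: real assume zw: "z \<in> {0<..}" "w \<in> {0<..}" "g z = g w"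
    then have "z\<^sup>2 * (1 + w\<^sup>2) = w\<^sup>2 * (1 + z\<^sup>2)"
      using pos[of z] pos[of w] by (simp add: g_def frac_eq_eq)
    then have "z\<^sup>2 = w\<^sup>2" by (simp add: algebra_simps)
    then show "z = w" using zw by simp
  qed
  have img: "g ` {0<..} = {0<..<1}"
  proof (intro equalityI subsetI)
    fix u :: real assume "u \<in> {0<..<1}"
    then have u: "0 < u" "u < 1" by auto
    \<comment> \<open>The witness is the positive solution \<open>z\<close> of
      \<open>z\<^sup>2 / (1 + z\<^sup>2) = u\<close>.\<close>
    have "g (sqrt (u / (1 - u))) = u" "sqrt (u / (1 - u)) > 0"
      using u by (auto simp: g_def field_simps)
    then show "u \<in> g ` {0<..}" by (metis greaterThan_iff image_eqI)
  qed (auto simp: g_def pos)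
  have der: "(g has_field_derivative g' z) (at z within {0<..})" for z
  proof -
    have "1 + z\<^sup>2 \<noteq> 0" using pos[of z] by simp
    then show ?thesis
      unfolding g_def g'_def
      by (auto intro!: derivative_eq_intros simp: power2_eq_square algebra_simps divide_simps)
  qed
  \<comment> \<open>The shift by -1 in the exponents of \<open>f\<close> leaves a factor
    \<open>(z + inverse z)\<^sup>2\<close>, which the Jacobian \<open>g' z\<close> reduces to
    \<open>2 / z\<close>. This 2 is the source of the half in \<open>Beta a a / 2\<close>.\<close>
  have eq: "\<bar>g' z\<bar> * f (g z) = 2 * h z" if "z > 0" for z
  proof -
    have 1: "1 - g z = 1 / (1 + z\<^sup>2)" using pos[of z] by (simp add: g_def field_simps)
    have 2: "g z * (1 - g z) = (z + inverse z) powr (-2)"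
    proof -
      have "z + inverse z = (1 + z\<^sup>2) / z" using that by (simp add: field_simps power2_eq_square)
      moreover have "(z + inverse z) powr (-2) = 1 / (z + inverse z)\<^sup>2"
        using that by (simp add: powr_minus_divide add_pos_pos)
      ultimately show ?thesis unfolding 1 using that
        by (simp add: g_def power2_eq_square)
    qed
    have "g z > 0" "1 - g z > 0" using that pos[of z] unfolding 1 by (auto simp: g_def)
    then have "f (g z) = (g z * (1 - g z)) powr (a - 1)"
      by (simp add: f_def powr_mult)
    also have "\<dots> = (z + inverse z) powr (- (2 * a)) * (z + inverse z) powr 2"
      unfolding 2 by (simp add: powr_powr algebra_simps flip: powr_add)
    also have "(z + inverse z) powr 2 = (1 + z\<^sup>2)\<^sup>2 / z\<^sup>2"
      using that by (simp add: add_pos_pos field_simps power2_eq_square)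
    finally show ?thesis
      using that pos[of z] by (simp add: g'_def h_def power2_eq_square)
  qed
  \<comment> \<open>The end points are dropped to match the image of \<open>g\<close>; nonnegativity
    of \<open>f\<close> then gives the absolute integrability that the change of variables
    requires.\<close>
  have "(f has_integral Beta a a) {0<..<1}"
    using has_integral_Beta_real[OF assms assms] by (simp add: has_integral_Icc_iff_Ioo f_def)
  then have "f absolutely_integrable_on g ` {0<..} \<and> integral (g ` {0<..}) f = Beta a a"
    unfolding img by (auto intro!: nonnegative_absolutely_integrable_1 integral_unique simp: f_def)
  then have "(\<lambda>z. \<bar>g' z\<bar> * f (g z)) absolutely_integrable_on {0<..} \<and>
             integral {0<..} (\<lambda>z. \<bar>g' z\<bar> * f (g z)) = Beta a a"
    by (subst has_absolute_integral_change_of_variables_1'[OF _ der inj]) auto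
  then have I: "((\<lambda>z. \<bar>g' z\<bar> * f (g z)) has_integral Beta a a) {0<..}"
    by (metis absolutely_integrable_on_def integrable_integral)
  have "((\<lambda>z. 2 * h z) has_integral Beta a a) {0<..}"
    by (rule has_integral_eq[OF _ I]) (simp add: eq)
  then have "(h has_integral Beta a a / 2) {0<..}"
    using has_integral_mult_right[of "\<lambda>z. 2 * h z" "Beta a a" _ "1/2"] by simp
  then have "((\<lambda>z. indicator {0<..} z * h z) has_integral Beta a a / 2) UNIV"
    using has_integral_restrict_UNIV[of "{0<..}" h "Beta a a / 2"]
    by (simp add: indicator_times_eq_if)
  moreover have "(\<lambda>z. indicator {0<..} z * h z) \<in> borel_measurable borel"
    unfolding h_def by measurable
  moreover have "0 \<le> indicator {0<..} z * h z" for z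
    by (simp add: h_def indicator_def)
  moreover have "0 \<le> Beta a a / 2"
    using assms by (simp add: Beta_def Gamma_real_pos less_imp_le)
  \<comment> \<open>For a nonnegative Borel function the gauge integral is also the Lebesgue
    integral.\<close>
  ultimately have "has_bochner_integral lborel (\<lambda>z. indicator {0<..} z * h z) (Beta a a / 2)"
    by (intro has_bochner_integral_nn_integral nn_integral_has_integral_lborel) auto
  then show ?thesis by (simp add: h_def)
qed

text \<open>The integrand is a product of functions of single coordinates, so the integral
  factorises. The exponent \<open>4 * \<alpha> * y e\<close> is twice
  \<open>2 * \<alpha> * y e\<close>, which is the argument of Beta.\<close>

lemma stringy_box_eq_Beta:
  fixes G :: "('v, 'e) multigraph"
  assumes "finite (edges G)" and "\<And>e. e \<in> edges G \<Longrightarrow> y e > 0" and "\<alpha> > 0"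
  shows "stringy_box G y \<alpha> = (\<Prod>e\<in>edges G. \<alpha> / 2 * Beta (2 * \<alpha> * y e) (2 * \<alpha> * y e))"
proof -
  let ?P = "\<Pi>\<^sub>M e\<in>edges G. (lborel :: real measure)"
  let ?h = "\<lambda>e z::real. indicator {0<..} z * (1 / z * (z + inverse z) powr (- (2 * (2 * \<alpha> * y e))))"
  have H: "has_bochner_integral lborel (?h e) (Beta (2 * \<alpha> * y e) (2 * \<alpha> * y e) / 2)"
    if "e \<in> edges G" for e
    using that assms by (intro has_bochner_integral_Beta_symmetric) simp
  have "(LINT z:(\<Pi>\<^sub>E e\<in>edges G. {0<..})|?P. (\<Prod>e\<in>edges G. 1 / z e) *
        (\<Prod>e\<in>edges G. (z e + inverse (z e)) powr (- (4 * \<alpha> * y e))))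
      = (LINT z|?P. (\<Prod>e\<in>edges G. ?h e (z e)))"
    unfolding set_lebesgue_integral_def
  proof (rule Bochner_Integration.integral_cong[OF refl])
    fix z assume "z \<in> space ?P"
    then have "z \<in> extensional (edges G)" by (simp add: space_PiM PiE_iff)
    then show "indicator (\<Pi>\<^sub>E e\<in>edges G. {0<..}) z *\<^sub>R ((\<Prod>e\<in>edges G. 1 / z e) *
        (\<Prod>e\<in>edges G. (z e + inverse (z e)) powr (- (4 * \<alpha> * y e)))) = (\<Prod>e\<in>edges G. ?h e (z e))"
      using assms(1) by (simp add: indicator_PiE_extensional mult.assoc flip: prod.distrib)
  qed
  also have "\<dots> = (\<Prod>e\<in>edges G. LINT z|lborel. ?h e z)"
    using assms(1) H by (intro lborel_PiM.product_integral_prod) (auto simp: has_bochner_integral_iff)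
  also have "\<dots> = (\<Prod>e\<in>edges G. Beta (2 * \<alpha> * y e) (2 * \<alpha> * y e) / 2)"
    using H by (intro prod.cong refl has_bochner_integral_integral_eq)
  finally show ?thesis
    by (simp add: stringy_box_def prod.distrib prod_dividef)
qed

text \<open>With \<open>s = 2 * \<alpha> * c\<close>, \<open>Beta s s\<close> is
  \<open>Gamma s\<close> squared over \<open>Gamma (2 * s)\<close> and behaves like
  \<open>2 / s\<close> near 0. Writing each Gamma through \<open>Gamma (s + 1) = s * Gamma s\<close>
  removes the poles and leaves \<open>1 / (2 * c)\<close> times a function tending to 1.\<close>

lemma tendsto_Beta_symmetric:
  fixes c :: real
  assumes "c > 0"
  shows "((\<lambda>\<alpha>. \<alpha> / 2 * Beta (2 * \<alpha> * c) (2 * \<alpha> * c)) \<longlongrightarrow> 1 / (2 * c)) (at_right 0)"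
proof -
  have "((\<lambda>\<alpha>. 1 / (2 * c) * (Gamma (2 * \<alpha> * c + 1) * Gamma (2 * \<alpha> * c + 1) / Gamma (4 * \<alpha> * c + 1)))
      \<longlongrightarrow> 1 / (2 * c) * (Gamma (2 * 0 * c + 1) * Gamma (2 * 0 * c + 1) / Gamma (4 * 0 * c + 1))) (at_right 0)"
    by (intro tendsto_intros) (auto simp: Gamma_eq_zero_iff)
  then have "((\<lambda>\<alpha>. 1 / (2 * c) * (Gamma (2 * \<alpha> * c + 1) * Gamma (2 * \<alpha> * c + 1) / Gamma (4 * \<alpha> * c + 1)))
      \<longlongrightarrow> 1 / (2 * c)) (at_right 0)"
    by simp
  moreover have "\<forall>\<^sub>F \<alpha> in at_right 0.
      1 / (2 * c) * (Gamma (2 * \<alpha> * c + 1) * Gamma (2 * \<alpha> * c + 1) / Gamma (4 * \<alpha> * c + 1))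
      = \<alpha> / 2 * Beta (2 * \<alpha> * c) (2 * \<alpha> * c)"
    using eventually_at_right_less[of "0::real"]
  proof eventually_elim
    case (elim \<alpha>)
    have *: "Gamma (s + 1) = s * Gamma s" if "s > 0" for s :: real
      using that by (intro Gamma_plus1) (auto elim!: nonpos_Ints_cases)
    have "Gamma (4 * \<alpha> * c) > 0" "\<alpha> * c > 0" using elim assms by (simp_all add: Gamma_real_pos)
    moreover have "Gamma (2 * \<alpha> * c + 1) = 2 * \<alpha> * c * Gamma (2 * \<alpha> * c)"
      "Gamma (4 * \<alpha> * c + 1) = 4 * \<alpha> * c * Gamma (4 * \<alpha> * c)"
      using elim assms by (simp_all add: *)
    moreover have "2 * \<alpha> * c + 2 * \<alpha> * c = 4 * \<alpha> * c" by simp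
    ultimately show ?case
      using elim assms unfolding Beta_def by (simp add: divide_simps mult.assoc)
  qed
  ultimately show ?thesis
    by (rule Lim_transform_eventually)
qed

section \<open>The vertex-space integral\<close>

text \<open>A deformation of \<open>exp (- c \<bar>s\<bar>)\<close>, with \<open>\<beta>\<close> playing the role of \<open>1 / \<alpha>'\<close>.\<close>

definition soft_exp_abs :: "real \<Rightarrow> real \<Rightarrow> real \<Rightarrow> real" where
  "soft_exp_abs \<beta> c s = (exp (\<beta> * s) + exp (- (\<beta> * s))) powr (- (c / \<beta>))"

lemma soft_exp_abs_nonneg: "0 \<le> soft_exp_abs \<beta> c s"
  by (simp add: soft_exp_abs_def)

text \<open>Logarithms of \<open>exp \<bar>r\<bar> \<le> 2 * cosh r \<le> 2 * exp
  \<bar>r\<bar>\<close> at \<open>r = \<beta> * s\<close>, divided by \<open>\<beta>\<close>. The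
  lower bound yields the domination, and both together the limit.\<close>

lemma ln_exp_abs_bounds:
  fixes \<beta> s :: real
  assumes "\<beta> > 0"
  shows "\<bar>s\<bar> \<le> ln (exp (\<beta> * s) + exp (- (\<beta> * s))) / \<beta>"
    and "ln (exp (\<beta> * s) + exp (- (\<beta> * s))) / \<beta> \<le> \<bar>s\<bar> + ln 2 / \<beta>"
proof -
  let ?c = "exp (\<beta> * s) + exp (- (\<beta> * s))"
  have c: "?c > 0" by (simp add: add_pos_pos)
  have "exp (\<beta> * \<bar>s\<bar>) \<le> ?c" by (cases "s \<ge> 0") auto
  then have "\<beta> * \<bar>s\<bar> \<le> ln ?c" using c by (simp add: ln_ge_iff)
  then show "\<bar>s\<bar> \<le> ln ?c / \<beta>" using assms by (simp add: field_simps)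
  have "\<beta> * s \<le> \<beta> * \<bar>s\<bar>" "- (\<beta> * s) \<le> \<beta> * \<bar>s\<bar>"
    using assms by (auto simp: abs_if mult_nonneg_nonpos)
  then have "?c \<le> exp (\<beta> * \<bar>s\<bar>) + exp (\<beta> * \<bar>s\<bar>)"
    by (intro add_mono) simp_all
  then have "ln ?c \<le> ln (2 * exp (\<beta> * \<bar>s\<bar>))" using c by simp
  also have "\<dots> = ln 2 + \<beta> * \<bar>s\<bar>" by (simp add: ln_mult)
  finally show "ln ?c / \<beta> \<le> \<bar>s\<bar> + ln 2 / \<beta>" using assms by (simp add: field_simps)
qed

text \<open>Moves the dependence on \<open>\<beta>\<close> into an exponent, where
  \<open>ln_exp_abs_bounds\<close> applies.\<close>

lemma soft_exp_abs_altdef: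
  "soft_exp_abs \<beta> c s = exp (- (c * (ln (exp (\<beta> * s) + exp (- (\<beta> * s))) / \<beta>)))"
proof -
  have "exp (\<beta> * s) + exp (- (\<beta> * s)) \<noteq> 0"
    using add_pos_pos[OF exp_gt_zero exp_gt_zero] by (metis less_irrefl)
  then show ?thesis by (simp add: soft_exp_abs_def powr_def)
qed

lemma soft_exp_abs_le:
  assumes "\<beta> > 0" and "c \<ge> 0"
  shows "soft_exp_abs \<beta> c s \<le> exp (- (c * \<bar>s\<bar>))"
  unfolding soft_exp_abs_altdef exp_le_cancel_iff neg_le_iff_le
  using ln_exp_abs_bounds(1)[OF assms(1), of s] assms(2) by (rule mult_left_mono)

lemma tendsto_soft_exp_abs: "((\<lambda>\<beta>. soft_exp_abs \<beta> c s) \<longlongrightarrow> exp (- (c * \<bar>s\<bar>))) at_top"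
proof -
  have "((\<lambda>\<beta>. ln (exp (\<beta> * s) + exp (- (\<beta> * s))) / \<beta>) \<longlongrightarrow> \<bar>s\<bar>) at_top"
  proof (rule tendsto_sandwich)
    show "\<forall>\<^sub>F \<beta> in at_top. \<bar>s\<bar> \<le> ln (exp (\<beta> * s) + exp (- (\<beta> * s))) / \<beta>"
      using eventually_gt_at_top[of 0] by eventually_elim (rule ln_exp_abs_bounds)
    show "\<forall>\<^sub>F \<beta> in at_top. ln (exp (\<beta> * s) + exp (- (\<beta> * s))) / \<beta> \<le> \<bar>s\<bar> + ln 2 / \<beta>"
      using eventually_gt_at_top[of 0] by eventually_elim (rule ln_exp_abs_bounds)
    have "((\<lambda>\<beta>. \<bar>s\<bar> + ln 2 / \<beta>) \<longlongrightarrow> \<bar>s\<bar> + 0) at_top"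
      by (intro tendsto_intros tendsto_divide_0[OF tendsto_const] filterlim_ident
          filterlim_at_top_imp_at_infinity)
    then show "((\<lambda>\<beta>. \<bar>s\<bar> + ln 2 / \<beta>) \<longlongrightarrow> \<bar>s\<bar>) at_top" by simp
  qed simp
  then show ?thesis
    unfolding soft_exp_abs_altdef by (intro tendsto_intros)
qed

lemma integrable_exp_minus_abs:
  fixes c :: real
  assumes "c > 0"
  shows "integrable lborel (\<lambda>t. exp (- (c * \<bar>t\<bar>)))"
proof -
  have pos: "set_integrable lborel {0..} (\<lambda>t. exp (- c * t))"
  proof -
    have "(\<lambda>t. exp (- c * t)) absolutely_integrable_on {0..}"
      using has_integral_exp_minus_to_infinity[OF assms, of 0]
      by (intro nonnegative_absolutely_integrable_1) auto
    then show ?thesis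
      \<comment> \<open>Absolute integrability refers to the completed measure; a Borel function is
        integrable for it exactly when it is for \<open>lborel\<close>.\<close>
      unfolding set_integrable_def by (subst (asm) integrable_completion) auto
  qed
  then have neg: "integrable lborel (\<lambda>t. indicator {0..} (- t) *\<^sub>R exp (- c * (- t)))"
    unfolding set_integrable_def
    using lborel_integrable_real_affine[of "\<lambda>t. indicator {0..} t *\<^sub>R exp (- c * t)" "-1" 0] by simp
  show ?thesis
  \<comment> \<open>Both half-line terms contribute at \<open>t = 0\<close>, so their sum is a bound
    and not equal to the integrand everywhere.\<close>
  proof (rule Bochner_Integration.integrable_bound)
    show "integrable lborel (\<lambda>t. indicator {0..} t *\<^sub>R exp (- c * t)
        + indicator {0..} (- t) *\<^sub>R exp (- c * (- t)))"
      using pos neg unfolding set_integrable_def by (intro Bochner_Integration.integrable_add)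
  qed (auto simp: indicator_def abs_if intro!: AE_I2)
qed

text \<open>The hyperbolic cosine is even, so only the absolute difference of the end point values
  matters. Edge factors thereby become values of \<open>soft_exp_abs\<close> at
  \<open>edge_dist\<close>.\<close>

lemma edge_ratio_sum_exp:
  "edge_ratio_sum (\<lambda>v. exp (\<beta> * t v)) p = exp (\<beta> * edge_dist t p) + exp (- (\<beta> * edge_dist t p))"
proof (cases p)
  case (Upair u v)
  have "exp (\<beta> * (t u - t v)) + exp (- (\<beta> * (t u - t v)))
      = exp (\<beta> * \<bar>t u - t v\<bar>) + exp (- (\<beta> * \<bar>t u - t v\<bar>))"
    by (cases "t u \<ge> t v") (auto simp: algebra_simps)
  then show ?thesis
    by (simp add: Upair right_diff_distrib flip: exp_diff)
qed

text \<open>Allows \<open>z\<close> to be replaced by the exponential of its logarithmic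
  coordinates, a replacement justified at vertices only.\<close>

lemma edge_ratio_sum_cong:
  assumes "\<And>v. v \<in> set_uprod p \<Longrightarrow> z v = w v"
  shows "edge_ratio_sum z p = edge_ratio_sum w p"
  using assms by (cases p) auto

lemma edge_dist_nonneg: "0 \<le> edge_dist t p"
  by (cases p) auto

lemma measurable_edge_dist:
  assumes "set_uprod p \<subseteq> V"
  shows "(\<lambda>t. edge_dist t p) \<in> borel_measurable (\<Pi>\<^sub>M v\<in>V. lborel)"
proof (cases p)
  case (Upair u v)
  then have [simp]: "u \<in> V" "v \<in> V" using assms by auto
  have [measurable]: "(\<lambda>t. t u) \<in> borel_measurable (\<Pi>\<^sub>M v\<in>V. (lborel :: real measure))"
    "(\<lambda>t. t v) \<in> borel_measurable (\<Pi>\<^sub>M v\<in>V. (lborel :: real measure))"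
    using measurable_component_singleton[of u V "\<lambda>_. lborel :: real measure"]
      measurable_component_singleton[of v V "\<lambda>_. lborel :: real measure"] by auto
  show ?thesis unfolding Upair edge_dist_Upair by measurable
qed

section \<open>The vertex integrand in logarithmic coordinates and its limit\<close>

context fin_multigraph
begin

text \<open>With \<open>\<beta> = 1 / \<alpha>\<close> this is the integrand of
  \<open>stringy_zono\<close> in the coordinates \<open>t = \<alpha> * ln z\<close>, the factors
  \<open>1 / z\<close> being absorbed by the measure.\<close>

definition soft_integrand :: "('v \<Rightarrow> real) \<Rightarrow> ('e \<Rightarrow> real) \<Rightarrow> real \<Rightarrow> ('v \<Rightarrow> real) \<Rightarrow> real"
  where
  "soft_integrand x y \<beta> t = (\<Prod>v\<in>verts G. soft_exp_abs \<beta> (x v) (t v)) *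
     (\<Prod>e\<in>edges G. soft_exp_abs \<beta> (y e) (edge_dist t (ends G e)))"

lemma measurable_soft_integrand [measurable]:
  "soft_integrand x y \<beta> \<in> borel_measurable (\<Pi>\<^sub>M v\<in>verts G. lborel)"
proof -
  have "(\<lambda>t. soft_exp_abs \<beta> (y e) (edge_dist t (ends G e))) \<in> borel_measurable (\<Pi>\<^sub>M v\<in>verts G. lborel)"
    if "e \<in> edges G" for e
  proof -
    note measurable_edge_dist[OF ends_in_verts[OF that], measurable]
    show ?thesis unfolding soft_exp_abs_def by measurable
  qed
  moreover have "(\<lambda>t. soft_exp_abs \<beta> (x v) (t v)) \<in> borel_measurable (\<Pi>\<^sub>M v\<in>verts G. lborel)"
    if "v \<in> verts G" for v
    using that unfolding soft_exp_abs_def by measurable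
  ultimately show ?thesis
    unfolding soft_integrand_def[abs_def] by (intro borel_measurable_times borel_measurable_prod) auto
qed

lemma stringy_zono_eq:
  assumes "\<alpha> > 0"
  shows "stringy_zono G x y \<alpha> = (LINT t|(\<Pi>\<^sub>M v\<in>verts G. lborel). soft_integrand x y (1 / \<alpha>) t)"
proof -
  let ?V = "verts G" and ?P = "\<Pi>\<^sub>M v\<in>verts G. (lborel :: real measure)"
  have "(LINT z:(\<Pi>\<^sub>E v\<in>?V. {0<..})|?P. (\<Prod>v\<in>?V. 1 / z v) *
        (\<Prod>v\<in>?V. (z v + inverse (z v)) powr (- (\<alpha> * x v))) *
        (\<Prod>e\<in>edges G. edge_ratio_sum z (ends G e) powr (- (\<alpha> * y e))))
      = (LINT z:(\<Pi>\<^sub>E v\<in>?V. {0<..})|?P. (\<Prod>v\<in>?V. 1 / z v) *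
          soft_integrand x y (1 / \<alpha>) (\<lambda>v\<in>?V. \<alpha> * ln (z v)))"
    unfolding set_lebesgue_integral_def
  proof (rule Bochner_Integration.integral_cong[OF refl])
    fix z :: "'v \<Rightarrow> real"
    let ?t = "\<lambda>v\<in>?V. \<alpha> * ln (z v)"
    show "indicator (\<Pi>\<^sub>E v\<in>?V. {0<..}) z *\<^sub>R ((\<Prod>v\<in>?V. 1 / z v) *
        (\<Prod>v\<in>?V. (z v + inverse (z v)) powr (- (\<alpha> * x v))) *
        (\<Prod>e\<in>edges G. edge_ratio_sum z (ends G e) powr (- (\<alpha> * y e))))
      = indicator (\<Pi>\<^sub>E v\<in>?V. {0<..}) z *\<^sub>R ((\<Prod>v\<in>?V. 1 / z v) * soft_integrand x y (1 / \<alpha>) ?t)"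
    proof (cases "z \<in> (\<Pi>\<^sub>E v\<in>?V. {0<..})")
      case True
      \<comment> \<open>Positivity of the coordinates makes the logarithm invertible; outside the
        positive orthant the indicator annihilates both sides.\<close>
      have exp_t: "exp (1 / \<alpha> * ?t v) = z v" if "v \<in> ?V" for v
        using True that assms by (auto simp: PiE_iff)
      have "(z v + inverse (z v)) powr (- (\<alpha> * x v)) = soft_exp_abs (1 / \<alpha>) (x v) (?t v)"
        if "v \<in> ?V" for v
        unfolding soft_exp_abs_def exp_minus exp_t[OF that] by (simp add: mult.commute)
      moreover have "edge_ratio_sum z (ends G e) powr (- (\<alpha> * y e))
          = soft_exp_abs (1 / \<alpha>) (y e) (edge_dist ?t (ends G e))" if "e \<in> edges G" for e
      proof -
        have "edge_ratio_sum z (ends G e) = edge_ratio_sum (\<lambda>v. exp (1 / \<alpha> * ?t v)) (ends G e)"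
          using ends_in_verts[OF that] exp_t by (intro edge_ratio_sum_cong) (metis subsetD)
        then show ?thesis
          unfolding soft_exp_abs_def edge_ratio_sum_exp by (metis divide_divide_eq_right div_by_1 mult.commute)
      qed
      ultimately show ?thesis
        by (simp add: soft_integrand_def)
    qed simp
  qed
  then show ?thesis
    using integral_ln_substitution[OF finite_verts assms, of "soft_integrand x y (1 / \<alpha>)"]
    by (simp add: stringy_zono_def)
qed

lemma tendsto_stringy_zono:
  assumes "\<And>v. v \<in> verts G \<Longrightarrow> x v > 0" and "\<And>e. e \<in> edges G \<Longrightarrow> y e > 0"
  shows "(stringy_zono G x y \<longlongrightarrow> (LINT t|(\<Pi>\<^sub>M v\<in>verts G. lborel).
           exp (- (\<Sum>v\<in>verts G. x v * \<bar>t v\<bar>) - (\<Sum>e\<in>edges G. y e * edge_dist t (ends G e))))) (at_right 0)"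
proof -
  let ?P = "\<Pi>\<^sub>M v\<in>verts G. (lborel :: real measure)"
  let ?f = "\<lambda>t. exp (- (\<Sum>v\<in>verts G. x v * \<bar>t v\<bar>) - (\<Sum>e\<in>edges G. y e * edge_dist t (ends G e)))"
  \<comment> \<open>The redundant absolute value of \<open>edge_dist\<close> brings each factor into
    the form of the limit in \<open>tendsto_soft_exp_abs\<close>.\<close>
  have f_eq: "?f t = (\<Prod>v\<in>verts G. exp (- (x v * \<bar>t v\<bar>))) *
      (\<Prod>e\<in>edges G. exp (- (y e * \<bar>edge_dist t (ends G e)\<bar>)))" for t
    by (simp add: finite_verts finite_edges edge_dist_nonneg sum_negf flip: exp_sum exp_add)
  have "((\<lambda>\<beta>. LINT t|?P. soft_integrand x y \<beta> t) \<longlongrightarrow> (LINT t|?P. ?f t)) at_top"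
  proof (rule integral_dominated_convergence_at_top)
    show "integrable ?P (\<lambda>t. \<Prod>v\<in>verts G. exp (- (x v * \<bar>t v\<bar>)))"
      using assms(1) by (intro lborel_PiM.product_integrable_prod finite_verts integrable_exp_minus_abs)
    show "\<forall>\<^sub>F \<beta> in at_top. AE t in ?P. norm (soft_integrand x y \<beta> t)
        \<le> (\<Prod>v\<in>verts G. exp (- (x v * \<bar>t v\<bar>)))"
      using eventually_gt_at_top[of 0]
    proof eventually_elim
      case (elim \<beta>)
      have "soft_integrand x y \<beta> t \<le> (\<Prod>v\<in>verts G. exp (- (x v * \<bar>t v\<bar>))) * 1" for t
        unfolding soft_integrand_def
      proof (rule mult_mono)
        show "(\<Prod>v\<in>verts G. soft_exp_abs \<beta> (x v) (t v)) \<le> (\<Prod>v\<in>verts G. exp (- (x v * \<bar>t v\<bar>)))"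
          using elim assms(1)
          by (intro prod_mono conjI soft_exp_abs_nonneg soft_exp_abs_le) (auto intro: less_imp_le)
        \<comment> \<open>Edge factors are bounded by 1 and leave the dominating function, which is
          then a product over single coordinates.\<close>
        have "soft_exp_abs \<beta> (y e) (edge_dist t (ends G e)) \<le> 1" if "e \<in> edges G" for e
          using soft_exp_abs_le[OF elim, of "y e" "edge_dist t (ends G e)"] assms(2)[OF that]
          by (auto elim!: order_trans)
        then show "(\<Prod>e\<in>edges G. soft_exp_abs \<beta> (y e) (edge_dist t (ends G e))) \<le> 1"
          by (intro prod_le_1) (auto simp: soft_exp_abs_nonneg)
      qed (auto intro!: prod_nonneg soft_exp_abs_nonneg)
      then show ?case
        by (auto simp: soft_integrand_def abs_mult abs_prod soft_exp_abs_nonneg)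
    qed
    have "((\<lambda>\<beta>. soft_integrand x y \<beta> t) \<longlongrightarrow> ?f t) at_top" for t
      unfolding soft_integrand_def f_eq by (intro tendsto_intros tendsto_soft_exp_abs)
    then show "AE t in ?P. ((\<lambda>\<beta>. soft_integrand x y \<beta> t) \<longlongrightarrow> ?f t) at_top"
      by simp
    have "(\<lambda>t. \<Sum>e\<in>edges G. y e * edge_dist t (ends G e)) \<in> borel_measurable ?P"
      by (intro borel_measurable_sum borel_measurable_times borel_measurable_const
          measurable_edge_dist ends_in_verts)
    then show "?f \<in> borel_measurable ?P"
      by measurable
  qed measurable
  \<comment> \<open>The limit at 0 from the right is taken as a limit at infinity through
    \<open>\<alpha> = inverse \<beta>\<close>.\<close>
  moreover have "\<forall>\<^sub>F \<beta> in at_top. (LINT t|?P. soft_integrand x y \<beta> t) = stringy_zono G x y (inverse \<beta>)"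
    using eventually_gt_at_top[of 0]
    by eventually_elim (simp add: stringy_zono_eq inverse_eq_divide)
  ultimately show ?thesis
    unfolding filterlim_at_right_to_top by (rule Lim_transform_eventually)
qed

end

section \<open>Beta product, edge-space limit and correlator limit combined\<close>

theorem mainTheorem2:
  fixes G :: "('v, 'e) multigraph"
    and x :: "'v \<Rightarrow> real" and y :: "'e \<Rightarrow> real"
  assumes "fin_multigraph G"
    and "connected_multigraph G"
    and "loopless G"
    and "\<And>v. v \<in> verts G \<Longrightarrow> x v > 0"
    and "\<And>e. e \<in> edges G \<Longrightarrow> y e > 0"
  shows "(\<forall>\<alpha>>0. stringy_box G y \<alpha> =
            (\<Prod>e\<in>edges G. \<alpha> / 2 * Beta (2 * \<alpha> * y e) (2 * \<alpha> * y e))) \<and>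
         (stringy_box G y \<longlongrightarrow> (\<Prod>e\<in>edges G. 1 / (2 * y e))) (at_right 0) \<and>
         (stringy_corr G x y \<longlongrightarrow> graph_correlator G x y) (at_right 0)"
proof -
  interpret fin_multigraph G by fact
  have box_eq: "stringy_box G y \<alpha> = (\<Prod>e\<in>edges G. \<alpha> / 2 * Beta (2 * \<alpha> * y e) (2 * \<alpha> * y e))"
    if "\<alpha> > 0" for \<alpha>
    using that assms(5) by (intro stringy_box_eq_Beta finite_edges)
  have "((\<lambda>\<alpha>. \<Prod>e\<in>edges G. \<alpha> / 2 * Beta (2 * \<alpha> * y e) (2 * \<alpha> * y e))
      \<longlongrightarrow> (\<Prod>e\<in>edges G. 1 / (2 * y e))) (at_right 0)"
    using assms(5) by (intro tendsto_prod tendsto_Beta_symmetric)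
  moreover have "\<forall>\<^sub>F \<alpha> in at_right 0.
      (\<Prod>e\<in>edges G. \<alpha> / 2 * Beta (2 * \<alpha> * y e) (2 * \<alpha> * y e)) = stringy_box G y \<alpha>"
    using eventually_at_right_less[of "0::real"] by eventually_elim (simp add: box_eq)
  ultimately have box: "(stringy_box G y \<longlongrightarrow> (\<Prod>e\<in>edges G. 1 / (2 * y e))) (at_right 0)"
    by (rule Lim_transform_eventually)
  \<comment> \<open>The edge-space limit is the prefactor of \<open>graph_correlator\<close> and the
    vertex-space limit is its integral.\<close>
  moreover have "(stringy_corr G x y \<longlongrightarrow> graph_correlator G x y) (at_right 0)"
    unfolding stringy_corr_def[abs_def] graph_correlator_def
    using assms(4,5) by (intro tendsto_mult box tendsto_stringy_zono)
  ultimately show ?thesis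
    using box_eq by blast
qed

end
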